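(* Let $q\ge 1$, $n\ge 0$ and $k\ge 1$ be integers. Then $$a(n+q-1,k)=\begin{cases}\dfrac{1}{k}\left(a(n,k-1)+(-1)^{k+\frac{n}{q}}\dbinom{n/q}{k-1}\right), & \text{if } q\mid n,\\[2mm] \dfrac{1}{k}\,a(n,k-1), & \text{otherwise.}\end{cases}$$
   Context: $S_n$ is the set of all permutations of $[n]=\{1,2,\ldots,n\}$ (with $S_0$ consisting of the single empty permutation). For a fixed integer $q\ge 1$, an adjacent $q$-cycle (A$q$C) of a permutation $\pi\in S_n$ is a cycle of length $q$ in the disjoint cycle decomposition of $\pi$ of the form $(a,a+1,a+2,\ldots,a+q-1)$, i.e. $\pi(a+i)=a+i+1$ for $0\le i\le q-2$ and $\pi(a+q-1)=a$ (for $q=1$ this is a fixed point). For fixed $q$, $a(n,k)$ denotes the number of permutations $\pi\in S_n$ having exactly $k$ A$q$C's; in particular $a(n,k)=0$ if $k>\lfloor n/q\rfloor$. *)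

theory Defs
  imports Complex_Main "HOL-Combinatorics.Permutations"
begin

text \<open>The permutations of \<open>[n] = {1, \<dots>, n}\<close> are the functions \<open>p\<close> with
  \<open>p permutes {1..n}\<close>. Such a \<open>p\<close> is a function on all of \<open>nat\<close> that fixes every point outside
  \<open>{1..n}\<close>, so an adjacent cycle is explicitly required to lie inside \<open>{1..n}\<close>; for \<open>q = 1\<close> the
  points outside would otherwise count as fixed points.\<close>

definition adjacent_cycle_at :: "nat \<Rightarrow> nat \<Rightarrow> (nat \<Rightarrow> nat) \<Rightarrow> nat \<Rightarrow> bool" where
  "adjacent_cycle_at q n p a \<longleftrightarrow>
     {a..<a + q} \<subseteq> {1..n} \<and>
     (\<forall>i. i + 1 < q \<longrightarrow> p (a + i) = a + i + 1) \<and> p (a + q - 1) = a"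

text \<open>For \<open>q \<ge> 1\<close>, an adjacent \<open>q\<close>-cycle \<open>(a, a+1, \<dots>, a+q-1)\<close> is determined by its least
  element \<open>a\<close>, so the adjacent \<open>q\<close>-cycles are counted by their least elements.\<close>

definition num_adjacent_cycles :: "nat \<Rightarrow> nat \<Rightarrow> (nat \<Rightarrow> nat) \<Rightarrow> nat" where
  "num_adjacent_cycles q n p = card {a. adjacent_cycle_at q n p a}"

definition num_perms :: "nat \<Rightarrow> nat \<Rightarrow> nat \<Rightarrow> nat" where
  "num_perms q n k = card {p. p permutes {1..n} \<and> num_adjacent_cycles q n p = k}"

end

theory Submission
  imports Defs
begin

text \<open>
  The proof is by inclusion--exclusion. Let \<open>M(n, j)\<close> be the sum over all permutations \<open>\<pi>\<close> of
  \<open>[n]\<close> of \<open>m(\<pi>) choose j\<close>, where \<open>m(\<pi>)\<close> is the number of adjacent \<open>q\<close>-cycles of \<open>\<pi>\<close>. Binomial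
  inversion, applied to each permutation separately, gives
  \<open>a(n, k) = (\<Sum>j. (-1)^(j+k) * (j choose k) * M(n, j))\<close> (\<open>num_perms_eq_alternating_sum\<close>).

  The number \<open>M(n, j)\<close> counts pairs of a permutation and a choice of \<open>j\<close> of its adjacent cycles.
  Choose the cycles first: \<open>j\<close> pairwise disjoint blocks of length \<open>q\<close> can be placed in \<open>[n]\<close> in
  \<open>(n - (q-1)j) choose j\<close> ways, as one sees by contracting every block to a point
  (\<open>card_separated_starts\<close>), and then the remaining \<open>n - qj\<close> points can be permuted freely
  (\<open>card_perms_with_adjacent_cycles\<close>). Hence \<open>j! M(n, j) = (n - (q-1)j)!\<close> if \<open>qj \<le> n\<close>, and
  \<open>M(n, j) = 0\<close> otherwise (\<open>fact_times_cycle_moment\<close>).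

  Replacing \<open>(n, j)\<close> by \<open>(n+q-1, j+1)\<close> leaves the number \<open>n - (q-1)j\<close> unchanged, so
  \<open>(j+1) M(n+q-1, j+1) = M(n, j)\<close>, with one exception: the condition \<open>qj \<le> n\<close> turns into
  \<open>qj < n\<close>. If \<open>qj = n\<close>, the left-hand side is \<open>0\<close> while \<open>M(n, j) = 1\<close>
  (\<open>cycle_moment_shift\<close>). Since \<open>k * (j+1 choose k) = (j+1) * (j choose k-1)\<close>, the alternating sum
  for \<open>k a(n+q-1, k)\<close> becomes termwise the one for \<open>a(n, k-1)\<close>, and the exceptional term
  \<open>j = n/q\<close> yields the correction that is present exactly when \<open>q\<close> divides \<open>n\<close>.
\<close>

section \<open>Binomial inversion\<close>

text \<open>Since \<open>(m choose j) * (j choose k) = (m choose k) * ((m-k) choose (j-k))\<close>, the sum is a multiple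
  of a full alternating row sum of Pascal's triangle, which vanishes unless the row is \<open>m - k = 0\<close>.\<close>

lemma binomial_orthogonality:
  fixes m k L :: nat
  assumes "m \<le> L"
  shows "(\<Sum>j\<le>L. (-1) ^ (j + k) * int (j choose k) * int (m choose j)) = (if m = k then 1 else 0)"
proof -
  have "(\<Sum>j\<le>L. (-1) ^ (j + k) * int (j choose k) * int (m choose j))
      = (\<Sum>j\<in>{k..m}. (-1) ^ (j + k) * int (j choose k) * int (m choose j))"
    by (rule sum.mono_neutral_right) (use assms in \<open>auto simp: not_le binomial_eq_0\<close>)
  also have "\<dots> = (\<Sum>j\<in>{k..m}. int (m choose k) * ((-1) ^ (j + k) * int ((m - k) choose (j - k))))"
  proof (rule sum.cong)
    fix j assume "j \<in> {k..m}"
    then have "(m choose j) * (j choose k) = (m choose k) * ((m - k) choose (j - k))"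
      by (simp add: choose_mult)
    then have "int (m choose j) * int (j choose k) = int (m choose k) * int ((m - k) choose (j - k))"
      by (metis of_nat_mult)
    then show "(-1) ^ (j + k) * int (j choose k) * int (m choose j)
        = int (m choose k) * ((-1) ^ (j + k) * int ((m - k) choose (j - k)))"
      by (simp add: mult.commute mult.left_commute)
  qed simp
  also have "\<dots> = (if m = k then 1 else 0)"
  proof (cases "k \<le> m")
    case True
    have "(\<Sum>j\<in>{k..m}. (-1) ^ (j + k) * int ((m - k) choose (j - k)))
        = (\<Sum>i\<le>m - k. (-1) ^ i * int ((m - k) choose i))"
      by (rule sum.reindex_bij_witness[where i = "\<lambda>i. i + k" and j = "\<lambda>j. j - k"])
        (use True in \<open>auto simp: uminus_power_if\<close>)
    moreover have "\<dots> = 0" if "m \<noteq> k"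
      using choose_alternating_sum[of "m - k", where ?'a = int] that True by simp
    ultimately show ?thesis
      by (auto simp flip: sum_distrib_left)
  qed simp
  finally show ?thesis .
qed

section \<open>Placements of disjoint blocks\<close>

text \<open>A placement of pairwise disjoint blocks of length \<open>q\<close> is encoded by the set of their left
  endpoints, since a family of adjacent cycles is later given in this form.\<close>

definition separated_starts :: "nat \<Rightarrow> nat \<Rightarrow> nat \<Rightarrow> nat set set" where
  "separated_starts q n j =
     {A. (\<forall>a\<in>A. 1 \<le> a \<and> a + q \<le> n + 1) \<and> (\<forall>a\<in>A. \<forall>b\<in>A. a < b \<longrightarrow> a + q \<le> b) \<and>
         finite A \<and> card A = j}"

lemma finite_separated_starts: "finite (separated_starts q n j)"
proof (rule finite_subset)
  show "separated_starts q n j \<subseteq> Pow {..n + 1}"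
    by (force simp: separated_starts_def)
qed simp

text \<open>Split according to whether the rightmost possible block is used.\<close>

lemma separated_starts_rec:
  assumes "q \<ge> 1"
  shows "separated_starts q (m + q) (Suc i)
    = separated_starts q (m + q - 1) (Suc i) \<union> insert (m + 1) ` separated_starts q m i"
    (is "?L = ?R1 \<union> ?R2")
proof (intro equalityI subsetI)
  fix A assume A: "A \<in> ?L"
  show "A \<in> ?R1 \<union> ?R2"
  proof (cases "m + 1 \<in> A")
    case True
    have "b + q \<le> m + 1" if "b \<in> A - {m + 1}" for b
    proof -
      have "b + q \<le> m + q + 1" and "b \<noteq> m + 1"
        using A that by (auto simp: separated_starts_def)
      then have "b < m + 1" by simp
      then show ?thesis
        using A that True by (auto simp: separated_starts_def)
    qed
    then have "A - {m + 1} \<in> separated_starts q m i"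
      using A True by (auto simp: separated_starts_def)
    moreover have "A = insert (m + 1) (A - {m + 1})"
      using True by auto
    ultimately show ?thesis by blast
  next
    case False
    have "b + q \<le> m + q - 1 + 1" if "b \<in> A" for b
    proof -
      have "b + q \<le> m + q + 1" using A that by (auto simp: separated_starts_def)
      moreover have "b \<noteq> m + 1" using False that by auto
      ultimately show ?thesis using assms by simp
    qed
    then have "A \<in> ?R1"
      using A by (auto simp: separated_starts_def)
    then show ?thesis ..
  qed
next
  fix A assume "A \<in> ?R1 \<union> ?R2"
  then show "A \<in> ?L"
  proof
    assume "A \<in> ?R1"
    then show ?thesis by (force simp: separated_starts_def)
  next
    assume "A \<in> ?R2"
    then obtain B where B: "B \<in> separated_starts q m i" and A: "A = insert (m + 1) B" by auto
    have le: "1 \<le> b \<and> b + q \<le> m + 1" if "b \<in> B" for b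
      using B that by (auto simp: separated_starts_def)
    then have "m + 1 \<notin> B" using assms by fastforce
    moreover have "\<not> m + 1 < b" if "b \<in> B" for b
      using le[OF that] by simp
    ultimately show ?thesis
      using B le by (force simp: separated_starts_def A)
  qed
qed

text \<open>Contracting every block to a point turns a placement into a \<open>j\<close>-subset of
  \<open>[n - (q-1)j]\<close>. On the level of numbers this is Pascal's rule, matched to the recursion above.
  The truncated subtraction is harmless: if \<open>n < (q-1)j\<close>, then both sides vanish.\<close>

lemma card_separated_starts:
  assumes "q \<ge> 1"
  shows "card (separated_starts q n j) = (n - (q - 1) * j) choose j"
proof (induction n arbitrary: j rule: less_induct)
  case (less n)
  show ?case
  proof (cases j)
    case 0
    have "separated_starts q n 0 = {{}}"
      by (auto simp: separated_starts_def)
    then show ?thesis using 0 by simp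
  next
    case (Suc i)
    show ?thesis
    proof (cases "n < q")
      case True
      have "separated_starts q n (Suc i) = {}"
      proof (rule ccontr)
        assume "separated_starts q n (Suc i) \<noteq> {}"
        then obtain A where A: "A \<in> separated_starts q n (Suc i)" by blast
        then obtain a where "a \<in> A" by (fastforce simp: separated_starts_def)
        then have "1 \<le> a" "a + q \<le> n + 1" using A by (auto simp: separated_starts_def)
        then show False using True by simp
      qed
      moreover have "n - (q - 1) * Suc i = 0" using True by simp
      ultimately show ?thesis unfolding Suc by (metis binomial_0_Suc card.empty)
    next
      case False
      then obtain m where n: "n = m + q" by (metis add.commute le_Suc_ex not_less)
      have fresh: "m + 1 \<notin> B" if "B \<in> separated_starts q m i" for B
        using that assms by (fastforce simp: separated_starts_def)
      have inj: "inj_on (insert (m + 1)) (separated_starts q m i)"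
        by (rule inj_onI) (metis fresh insert_ident)
      have disj: "separated_starts q (m + q - 1) (Suc i) \<inter> insert (m + 1) ` separated_starts q m i = {}"
        using assms by (fastforce simp: separated_starts_def)
      have "card (separated_starts q n (Suc i))
          = card (separated_starts q (m + q - 1) (Suc i)) + card (separated_starts q m i)"
        unfolding n separated_starts_rec[OF assms]
        by (simp add: card_Un_disjoint finite_separated_starts disj[simplified] card_image inj[simplified])
      also have "card (separated_starts q (m + q - 1) (Suc i)) = (m + q - 1 - (q - 1) * Suc i) choose Suc i"
        using less[of "m + q - 1"] n assms by simp
      also have "m + q - 1 - (q - 1) * Suc i = m - (q - 1) * i"
        using assms by simp
      also have "card (separated_starts q m i) = (m - (q - 1) * i) choose i"
        using less[of m] n assms by simp
      also have "(m - (q - 1) * i choose Suc i) + (m - (q - 1) * i choose i)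
          = (m + 1 - (q - 1) * i) choose Suc i"
      proof (cases "(q - 1) * i \<le> m")
        case True
        then show ?thesis by (simp add: Suc_diff_le)
      next
        case False
        then have "i \<noteq> 0" by (cases i) auto
        then show ?thesis using False by (simp add: binomial_eq_0)
      qed
      also have "m + 1 - (q - 1) * i = n - (q - 1) * Suc i"
        using assms n by (cases q) auto
      finally show ?thesis by (simp add: Suc)
    qed
  qed
qed

section \<open>Permutations with prescribed adjacent cycles\<close>

text \<open>Permutations that agree with a fixed permutation \<open>c\<close> on \<open>U\<close> form the coset of \<open>c\<close> by the
  permutations fixing \<open>U\<close> pointwise.\<close>

lemma card_perms_agreeing_on:
  assumes c: "c permutes S" and fin: "finite S"
  shows "card {p. p permutes S \<and> (\<forall>x\<in>U. p x = c x)} = fact (card (S - U))"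
proof -
  have "{p. p permutes S \<and> (\<forall>x\<in>U. p x = c x)} = (\<lambda>g. c \<circ> g) ` {g. g permutes S - U}"
  proof (intro equalityI subsetI)
    fix p assume p: "p \<in> {p. p permutes S \<and> (\<forall>x\<in>U. p x = c x)}"
    have "(inv c \<circ> p) permutes S"
      using p c by (auto intro: permutes_compose permutes_inv)
    moreover have "(inv c \<circ> p) x = x" if "x \<in> S - (S - U)" for x
      using p that permutes_inverses(2)[OF c] by auto
    ultimately have "(inv c \<circ> p) permutes S - U"
      by (rule permutes_superset)
    moreover have "p = c \<circ> (inv c \<circ> p)"
      using permutes_inverses(1)[OF c] by (auto simp: fun_eq_iff)
    ultimately show "p \<in> (\<lambda>g. c \<circ> g) ` {g. g permutes S - U}" by blast
  next
    fix p assume "p \<in> (\<lambda>g. c \<circ> g) ` {g. g permutes S - U}"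
    then obtain g where g: "g permutes S - U" and p: "p = c \<circ> g" by blast
    have "g permutes S" using g by (rule permutes_subset) auto
    then have "p permutes S" unfolding p using c by (rule permutes_compose)
    moreover have "p x = c x" if "x \<in> U" for x
      using permutes_not_in[OF g, of x] that by (simp add: p)
    ultimately show "p \<in> {p. p permutes S \<and> (\<forall>x\<in>U. p x = c x)}" by blast
  qed
  moreover have "inj_on (\<lambda>g. c \<circ> g) {g. g permutes S - U}"
    using permutes_inj[OF c] by (auto intro!: inj_onI simp: fun_eq_iff inj_def)
  ultimately have "card {p. p permutes S \<and> (\<forall>x\<in>U. p x = c x)} = card {g. g permutes S - U}"
    by (simp add: card_image)
  also have "\<dots> = fact (card (S - U))"
    using card_permutations[of "S - U"] fin by simp
  finally show ?thesis .
qed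

text \<open>The product of the adjacent \<open>q\<close>-cycles starting at the points of \<open>A\<close>. A point with
  \<open>x + 1 - q \<in> A\<close> is the right end of its block.\<close>

definition block_cycles :: "nat \<Rightarrow> nat set \<Rightarrow> nat \<Rightarrow> nat" where
  "block_cycles q A x =
     (if x \<in> (\<Union>a\<in>A. {a..<a + q}) then if \<exists>a\<in>A. a + q = x + 1 then x + 1 - q else x + 1 else x)"

lemma block_cycles_right_end:
  assumes "q \<ge> 1" and "a \<in> A" and "x + 1 = a + q"
  shows "block_cycles q A x = a"
  using assms by (auto simp: block_cycles_def intro!: bexI[of _ a])

lemma block_cycles_inner:
  assumes sep: "\<forall>a\<in>A. \<forall>b\<in>A. a < b \<longrightarrow> a + q \<le> b"
    and "a \<in> A" and "a \<le> x" and "x + 1 < a + q"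
  shows "block_cycles q A x = x + 1"
proof -
  have "b + q \<noteq> x + 1" if "b \<in> A" for b
  proof
    assume *: "b + q = x + 1"
    then have "b < a" using assms(4) by simp
    then have "b + q \<le> a" using sep that assms(2) by blast
    then show False using * assms(3) by simp
  qed
  then show ?thesis
    using assms by (auto simp: block_cycles_def)
qed

lemma block_cycles_permutes:
  assumes q: "q \<ge> 1" and fin: "finite A" and sep: "\<forall>a\<in>A. \<forall>b\<in>A. a < b \<longrightarrow> a + q \<le> b"
  shows "block_cycles q A permutes (\<Union>a\<in>A. {a..<a + q})" (is "_ permutes ?U")
proof (rule bij_imp_permutes)
  have "?U \<subseteq> block_cycles q A ` ?U"
  proof
    fix y assume "y \<in> ?U"
    then obtain a where a: "a \<in> A" "a \<le> y" "y < a + q" by auto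
    show "y \<in> block_cycles q A ` ?U"
    proof (cases "y = a")
      case True
      have "block_cycles q A (a + q - 1) = a"
        using block_cycles_right_end[of q a A "a + q - 1"] q a by simp
      moreover have "a + q - 1 \<in> ?U" using a q by (intro UN_I[of a]) auto
      ultimately show ?thesis
        using True by (intro image_eqI[where x = "a + q - 1"]) simp_all
    next
      case False
      then have y: "a \<le> y - 1" "y - 1 + 1 = y" using a by auto
      then have "block_cycles q A (y - 1) = y"
        using block_cycles_inner[OF sep a(1), of "y - 1"] a by simp
      moreover have "y - 1 \<in> ?U" using a y by (intro UN_I[of a]) auto
      ultimately show ?thesis
        by (intro image_eqI[where x = "y - 1"]) simp_all
    qed
  qed
  moreover have "finite ?U" using fin by simp
  \<comment> \<open>A map of a finite set onto a superset of it is a bijection of the set.\<close>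
  ultimately have "block_cycles q A ` ?U = ?U"
    using card_seteq[of "block_cycles q A ` ?U" ?U] card_image_le[of ?U "block_cycles q A"]
    by blast
  with \<open>finite ?U\<close> show "bij_betw (block_cycles q A) ?U ?U"
    by (simp add: bij_betw_def eq_card_imp_inj_on)
qed (auto simp: block_cycles_def)

lemma adjacent_cycle_at_iff_block_cycles:
  assumes q: "q \<ge> 1" and A: "A \<in> separated_starts q n j" and a: "a \<in> A"
  shows "adjacent_cycle_at q n p a \<longleftrightarrow> (\<forall>x\<in>{a..<a + q}. p x = block_cycles q A x)"
proof -
  have sep: "\<forall>a\<in>A. \<forall>b\<in>A. a < b \<longrightarrow> a + q \<le> b" and bnd: "1 \<le> a" "a + q \<le> n + 1"
    using A a by (auto simp: separated_starts_def)
  have sub: "{a..<a + q} \<subseteq> {1..n}" using bnd by auto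
  have last: "block_cycles q A (a + q - 1) = a"
    using block_cycles_right_end[OF q a] q by simp
  have inner: "block_cycles q A (a + i) = a + i + 1" if "i + 1 < q" for i
    using block_cycles_inner[OF sep a, of "a + i"] that by simp
  show ?thesis
  proof
    assume adj: "adjacent_cycle_at q n p a"
    show "\<forall>x\<in>{a..<a + q}. p x = block_cycles q A x"
    proof
      fix x assume x: "x \<in> {a..<a + q}"
      show "p x = block_cycles q A x"
      proof (cases "x = a + q - 1")
        case True
        then show ?thesis using adj last by (simp add: adjacent_cycle_at_def)
      next
        case False
        then have "x = a + (x - a)" "x - a + 1 < q" using x by auto
        then show ?thesis using adj inner by (metis adjacent_cycle_at_def)
      qed
    qed
  next
    assume eq: "\<forall>x\<in>{a..<a + q}. p x = block_cycles q A x"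
    have "p (a + i) = a + i + 1" if "i + 1 < q" for i
      using eq inner[OF that] that by simp
    moreover have "p (a + q - 1) = a"
      using eq last q by simp
    ultimately show "adjacent_cycle_at q n p a"
      using sub by (simp add: adjacent_cycle_at_def)
  qed
qed

lemma card_perms_with_adjacent_cycles:
  assumes q: "q \<ge> 1" and A: "A \<in> separated_starts q n j"
  shows "card {p. p permutes {1..n} \<and> (\<forall>a\<in>A. adjacent_cycle_at q n p a)} = fact (n - q * j)"
proof -
  let ?U = "\<Union>a\<in>A. {a..<a + q}"
  have sep: "\<forall>a\<in>A. \<forall>b\<in>A. a < b \<longrightarrow> a + q \<le> b" and fin: "finite A" and card: "card A = j"
    and bnd: "\<forall>a\<in>A. 1 \<le> a \<and> a + q \<le> n + 1"
    using A by (auto simp: separated_starts_def)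
  have sub: "?U \<subseteq> {1..n}" using bnd by fastforce
  have c: "block_cycles q A permutes {1..n}"
    using block_cycles_permutes[OF q fin sep] sub by (rule permutes_subset)
  have disj: "{a..<a + q} \<inter> {b..<b + q} = {}" if "a \<in> A" "b \<in> A" "a \<noteq> b" for a b
  proof (cases "a < b")
    case True
    then have "a + q \<le> b" using sep that by blast
    then show ?thesis by auto
  next
    case False
    then have "b + q \<le> a" using sep that by (metis linorder_neqE_nat)
    then show ?thesis by auto
  qed
  have "card ?U = (\<Sum>a\<in>A. card {a..<a + q})"
    by (rule card_UN_disjoint) (use fin disj in auto)
  then have cardU: "card ?U = q * j" using card by simp
  have "{p. p permutes {1..n} \<and> (\<forall>a\<in>A. adjacent_cycle_at q n p a)}
      = {p. p permutes {1..n} \<and> (\<forall>x\<in>?U. p x = block_cycles q A x)}"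
    using adjacent_cycle_at_iff_block_cycles[OF q A] by auto
  also have "card \<dots> = fact (card ({1..n} - ?U))"
    using c by (rule card_perms_agreeing_on) simp
  also have "card ({1..n} - ?U) = n - q * j"
    using sub cardU by (simp add: card_Diff_subset fin)
  finally show ?thesis .
qed

section \<open>Binomial moments of the number of adjacent cycles\<close>

definition cycle_moment :: "nat \<Rightarrow> nat \<Rightarrow> nat \<Rightarrow> nat" where
  "cycle_moment q n j = (\<Sum>p | p permutes {1..n}. num_adjacent_cycles q n p choose j)"

lemma adjacent_cycle_at_subset:
  assumes "q \<ge> 1"
  shows "{a. adjacent_cycle_at q n p a} \<subseteq> {1..n}"
proof
  fix a assume "a \<in> {a. adjacent_cycle_at q n p a}"
  then have "{a..<a + q} \<subseteq> {1..n}" by (simp add: adjacent_cycle_at_def)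
  moreover have "a \<in> {a..<a + q}" using assms by simp
  ultimately show "a \<in> {1..n}" by blast
qed

lemma num_perms_eq_alternating_sum:
  assumes q: "q \<ge> 1" and L: "n \<le> L"
  shows "int (num_perms q n k) = (\<Sum>j\<le>L. (-1) ^ (j + k) * int (j choose k) * int (cycle_moment q n j))"
proof -
  let ?P = "{p. p permutes {1..n}}"
  let ?m = "num_adjacent_cycles q n"
  have finP: "finite ?P" by (simp add: finite_permutations)
  have m: "?m p \<le> L" for p
    unfolding num_adjacent_cycles_def
    using card_mono[OF _ adjacent_cycle_at_subset[OF q, of n p]] L by fastforce
  have "int (num_perms q n k) = (\<Sum>p\<in>?P. if ?m p = k then 1 else 0)"
    using finP by (simp add: num_perms_def sum.If_cases Collect_conj_eq)
  also have "\<dots> = (\<Sum>p\<in>?P. \<Sum>j\<le>L. (-1) ^ (j + k) * int (j choose k) * int (?m p choose j))"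
    using binomial_orthogonality[OF m, of k] by simp
  also have "\<dots> = (\<Sum>j\<le>L. \<Sum>p\<in>?P. (-1) ^ (j + k) * int (j choose k) * int (?m p choose j))"
    by (rule sum.swap)
  finally show ?thesis
    by (simp add: cycle_moment_def sum_distrib_left)
qed

text \<open>If the second cycle started inside the first, then at the right end \<open>a + q - 1\<close> of the first
  it would step on to \<open>a + q\<close>, where the first one returns to \<open>a\<close>.\<close>

lemma adjacent_cycles_separated:
  assumes "adjacent_cycle_at q n p a" and "adjacent_cycle_at q n p b" and "a < b"
  shows "a + q \<le> b"
proof (rule ccontr)
  assume "\<not> a + q \<le> b"
  then have i: "(a + q - 1 - b) + 1 < q" "b + (a + q - 1 - b) = a + q - 1" "a + q - 1 + 1 = a + q"
    using assms(3) by auto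
  have "p (b + (a + q - 1 - b)) = b + (a + q - 1 - b) + 1"
    using assms(2) i(1) unfolding adjacent_cycle_at_def by blast
  then have "p (a + q - 1) = a + q" using i by simp
  moreover have "p (a + q - 1) = a" using assms(1) by (simp add: adjacent_cycle_at_def)
  ultimately show False using i(1) by simp
qed

text \<open>Both sides count the pairs of a permutation and \<open>j\<close> of its adjacent cycles. The sum can be
  restricted to separated sets because no permutation has overlapping adjacent cycles.\<close>

lemma cycle_moment_eq_sum_starts:
  assumes q: "q \<ge> 1"
  shows "cycle_moment q n j = (\<Sum>A\<in>separated_starts q n j.
    card {p. p permutes {1..n} \<and> (\<forall>a\<in>A. adjacent_cycle_at q n p a)})"
proof -
  let ?P = "{p. p permutes {1..n}}"
  let ?R = "\<lambda>p A. \<forall>a\<in>A. adjacent_cycle_at q n p a"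
  have finP: "finite ?P" by (simp add: finite_permutations)
  have "num_adjacent_cycles q n p choose j = (\<Sum>A | A \<in> separated_starts q n j \<and> ?R p A. 1)" for p
  proof -
    have fin: "finite {a. adjacent_cycle_at q n p a}"
      using adjacent_cycle_at_subset[OF q] by (rule finite_subset) simp
    have bnd: "1 \<le> a \<and> a + q \<le> n + 1" if "adjacent_cycle_at q n p a" for a
    proof -
      have "{a, a + q - 1} \<subseteq> {a..<a + q}" using q by auto
      then have "{a, a + q - 1} \<subseteq> {1..n}"
        using that unfolding adjacent_cycle_at_def by blast
      then show ?thesis by auto
    qed
    have "A \<in> separated_starts q n j \<and> ?R p A
        \<longleftrightarrow> A \<subseteq> {a. adjacent_cycle_at q n p a} \<and> card A = j" for A
    proof
      assume A: "A \<subseteq> {a. adjacent_cycle_at q n p a} \<and> card A = j"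
      then have "finite A" using fin finite_subset by blast
      moreover have "\<forall>a\<in>A. \<forall>b\<in>A. a < b \<longrightarrow> a + q \<le> b"
        using A adjacent_cycles_separated by blast
      moreover have "\<forall>a\<in>A. 1 \<le> a \<and> a + q \<le> n + 1"
        using A bnd by blast
      ultimately show "A \<in> separated_starts q n j \<and> ?R p A"
        using A by (auto simp: separated_starts_def)
    qed (auto simp: separated_starts_def)
    then have "{A. A \<in> separated_starts q n j \<and> ?R p A}
        = {A. A \<subseteq> {a. adjacent_cycle_at q n p a} \<and> card A = j}"
      by simp
    then show ?thesis
      using n_subsets[OF fin, of j] by (simp add: num_adjacent_cycles_def)
  qed
  then have "cycle_moment q n j = (\<Sum>p\<in>?P. \<Sum>A | A \<in> separated_starts q n j \<and> ?R p A. 1)"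
    by (simp add: cycle_moment_def)
  also have "\<dots> = (\<Sum>A\<in>separated_starts q n j. \<Sum>p | p \<in> ?P \<and> ?R p A. 1)"
    using finP finite_separated_starts by (rule sum.swap_restrict)
  finally show ?thesis by simp
qed

text \<open>With \<open>N = n - (q-1)j\<close>, the moment is \<open>(N choose j) * (N - j)!\<close>; multiplying by \<open>j!\<close> gives \<open>N!\<close>.
  If \<open>qj > n\<close>, the binomial coefficient is \<open>0\<close>.\<close>

lemma fact_times_cycle_moment:
  assumes q: "q \<ge> 1"
  shows "fact j * cycle_moment q n j = (if q * j \<le> n then fact (n - (q - 1) * j) else 0)"
proof -
  let ?N = "n - (q - 1) * j"
  have qj: "q * j = (q - 1) * j + j" using q by (cases q) auto
  have M: "cycle_moment q n j = (?N choose j) * fact (n - q * j)"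
    by (simp add: cycle_moment_eq_sum_starts[OF q] card_perms_with_adjacent_cycles[OF q]
        card_separated_starts[OF q] del: One_nat_def)
  show ?thesis
  proof (cases "q * j \<le> n")
    case True
    then have "j \<le> ?N" and "?N - j = n - q * j" using qj by auto
    then have "fact j * fact (n - q * j) * (?N choose j) = fact ?N"
      by (metis binomial_fact_lemma)
    then show ?thesis using True by (simp add: M mult_ac)
  next
    case False
    then have "j > 0" by (cases j) auto
    then have "?N < j" using False qj by linarith
    then show ?thesis using False by (simp add: M binomial_eq_0)
  qed
qed

lemma cycle_moment_shift:
  assumes q: "q \<ge> 1"
  shows "Suc j * cycle_moment q (n + q - 1) (Suc j) + (if n = q * j then 1 else 0) = cycle_moment q n j"
proof -
  have N: "n + q - 1 - (q - 1) * Suc j = n - (q - 1) * j" using q by simp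
  have le: "q * Suc j \<le> n + q - 1 \<longleftrightarrow> q * j < n" using q by auto
  have "fact j * (Suc j * cycle_moment q (n + q - 1) (Suc j))
      = fact (Suc j) * cycle_moment q (n + q - 1) (Suc j)"
    by (simp only: fact_Suc of_nat_id mult_ac)
  also have "\<dots> = (if q * j < n then fact (n - (q - 1) * j) else 0)"
    using fact_times_cycle_moment[OF q, of "Suc j" "n + q - 1"] by (simp only: N le)
  finally have 1: "fact j * (Suc j * cycle_moment q (n + q - 1) (Suc j))
      = (if q * j < n then fact (n - (q - 1) * j) else 0)" .
  \<comment> \<open>For \<open>n = q * j\<close> the factorial on the right is \<open>j!\<close>, so the missing moment is exactly \<open>1\<close>.\<close>
  have 2: "fact j * (if n = q * j then 1 else 0) = (if n = q * j then fact (n - (q - 1) * j) else (0 :: nat))"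
  proof (cases "n = q * j")
    case True
    then have e: "n - (q - 1) * j = j" using q by (cases q) auto
    show ?thesis unfolding e using True by simp
  qed simp
  have "fact j * (Suc j * cycle_moment q (n + q - 1) (Suc j) + (if n = q * j then 1 else 0))
      = (if q * j < n then fact (n - (q - 1) * j) else 0)
        + (if n = q * j then fact (n - (q - 1) * j) else 0)"
    by (simp only: distrib_left 1 2)
  also have "\<dots> = (if q * j \<le> n then fact (n - (q - 1) * j) else 0)"
    by (cases "q * j" n rule: linorder_cases) (simp_all only: less_irrefl if_True if_False, simp_all)
  also have "\<dots> = fact j * cycle_moment q n j"
    by (simp only: fact_times_cycle_moment[OF q])
  finally show ?thesis
    by (simp only: mult_cancel1) (simp del: mult_Suc)
qed

section \<open>The recurrence\<close>

text \<open>The absorption identity for \<open>Suc k * (Suc j choose Suc k)\<close> frees a factor \<open>Suc j\<close>, which is what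
  the shift of the moments needs. The term \<open>j = 0\<close> drops out because \<open>0 choose Suc k = 0\<close>.\<close>

lemma num_perms_recurrence:
  assumes q: "q \<ge> 1"
  shows "int (Suc k) * int (num_perms q (n + q - 1) (Suc k)) =
    int (num_perms q n k) - (if q dvd n then (-1) ^ (n div q + k) * int ((n div q) choose k) else 0)"
proof -
  \<comment> \<open>Any common cut-off for the two alternating sums that bounds both sizes will do.\<close>
  let ?L = "n + q"
  let ?M = "\<lambda>j. int (cycle_moment q n j)"
  let ?M' = "\<lambda>j. int (cycle_moment q (n + q - 1) j)"
  let ?c = "\<lambda>j. (-1) ^ (j + k) * int (j choose k)"
  have "int (Suc k) * int (num_perms q (n + q - 1) (Suc k))
      = int (Suc k) * (\<Sum>j\<le>Suc ?L. (-1) ^ (j + Suc k) * int (j choose Suc k) * ?M' j)"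
    using num_perms_eq_alternating_sum[OF q, of "n + q - 1" "Suc ?L" "Suc k"] by simp
  also have "\<dots> = (\<Sum>j\<le>?L. int (Suc k) * ((-1) ^ (Suc j + Suc k) * int (Suc j choose Suc k) * ?M' (Suc j)))"
    by (subst sum.atMost_Suc_shift) (simp add: sum_distrib_left)
  also have "\<dots> = (\<Sum>j\<le>?L. ?c j * ?M j - (if n = q * j then ?c j else 0))"
  proof (rule sum.cong)
    fix j
    have sgn: "(-1) ^ (Suc j + Suc k) = ((-1) ^ (j + k) :: int)"
      by simp
    have absorb: "int (Suc k) * int (Suc j choose Suc k) = int (Suc j) * int (j choose k)"
      by (metis Suc_times_binomial of_nat_mult)
    have "int (Suc j * cycle_moment q (n + q - 1) (Suc j) + (if n = q * j then 1 else 0)) = ?M j"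
      by (simp only: cycle_moment_shift[OF q])
    then have shift: "int (Suc j) * ?M' (Suc j) = ?M j - (if n = q * j then 1 else 0)"
      by (simp only: of_nat_add of_nat_mult if_distrib[of int] of_nat_1 of_nat_0 eq_diff_eq)
    have "int (Suc k) * ((-1) ^ (Suc j + Suc k) * int (Suc j choose Suc k) * ?M' (Suc j))
        = (-1) ^ (j + k) * (int (Suc k) * int (Suc j choose Suc k)) * ?M' (Suc j)"
      by (simp only: sgn mult_ac)
    also have "\<dots> = ?c j * (int (Suc j) * ?M' (Suc j))"
      unfolding absorb by (simp only: mult_ac)
    also have "\<dots> = ?c j * ?M j - (if n = q * j then ?c j else 0)"
      unfolding shift right_diff_distrib by simp
    finally show "int (Suc k) * ((-1) ^ (Suc j + Suc k) * int (Suc j choose Suc k) * ?M' (Suc j))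
        = ?c j * ?M j - (if n = q * j then ?c j else 0)" .
  qed simp
  also have "\<dots> = (\<Sum>j\<le>?L. ?c j * ?M j) - (\<Sum>j\<le>?L. if n = q * j then ?c j else 0)"
    by (rule sum_subtractf)
  also have "(\<Sum>j\<le>?L. ?c j * ?M j) = int (num_perms q n k)"
    using num_perms_eq_alternating_sum[OF q, of n ?L k] by simp
  also have "(\<Sum>j\<le>?L. if n = q * j then ?c j else 0) = (if q dvd n then ?c (n div q) else 0)"
  proof (cases "q dvd n")
    case True
    then have "n = q * j \<longleftrightarrow> j = n div q" for j using q by auto
    moreover have "n div q \<le> ?L" using div_le_dividend[of n q] by linarith
    ultimately show ?thesis using True by (simp add: sum.delta)
  next
    case False
    then have "n \<noteq> q * j" for j by auto
    then show ?thesis using False by simp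
  qed
  finally show ?thesis .
qed

theorem theorem2p3:
  fixes q n k :: nat
  assumes "q \<ge> 1" and "k \<ge> 1"
  shows "(of_nat (num_perms q (n + q - 1) k) :: rat) =
    (if q dvd n
     then 1 / of_nat k *
       (of_nat (num_perms q n (k - 1)) + (-1) ^ (k + n div q) * of_nat ((n div q) choose (k - 1)))
     else 1 / of_nat k * of_nat (num_perms q n (k - 1)))"
proof -
  obtain l where k: "k = Suc l" using assms(2) by (cases k) auto
  have "(of_int (int (Suc l) * int (num_perms q (n + q - 1) (Suc l))) :: rat) = of_int
    (int (num_perms q n l) - (if q dvd n then (-1) ^ (n div q + l) * int ((n div q) choose l) else 0))"
    by (simp only: num_perms_recurrence[OF assms(1)])
  then have "of_nat k * (of_nat (num_perms q (n + q - 1) k) :: rat) =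
    of_nat (num_perms q n (k - 1))
      + (if q dvd n then (-1) ^ (k + n div q) * of_nat ((n div q) choose (k - 1)) else 0)"
    by (simp add: k add.commute del: of_nat_Suc)
  moreover have "(of_nat k :: rat) \<noteq> 0" using assms(2) by simp
  ultimately show ?thesis by (simp add: field_simps)
qed

end
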